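(* Let $k$ be a field, let $S=k[x_1,\ldots,x_d]$ be the standard graded polynomial ring, let $I\subsetneq S$ be a homogeneous ideal, and let $R=S/I$. Let $s$ be the projective dimension of $R$ over $S$, and for $0\le i\le s$ let $t_i$ and $T_i$ denote the minimal and maximal shifts in homological degree $i$ of the minimal graded free $S$-resolution of $R$. Then $$t_n\leq t_1+T_{n-1}\qquad\text{for all } n \text{ with } 1\le n\le s.$$
   Context: Each variable $x_i$ has degree $1$. Let $\mathbb F: 0\to F_s\to\cdots\to F_1\to F_0=S$ be the minimal graded free resolution of $R=S/I$ over $S$, and write $F_a=\bigoplus_j S(-j)^{\beta_{aj}}$, where $S(-j)$ is $S$ with generator placed in degree $j$. The minimal and maximal shifts are $$t_a=\min\{j:\beta_{aj}\neq 0\},\qquad T_a=\max\{j:\beta_{aj}\neq 0\}\qquad(0\le a\le s).$$ In particular $t_0=T_0=0$. *)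

theory Defs
  imports
    "HOL-Algebra.QuotRing"
    "HOL-Algebra.Module"
    "HOL-Library.Poly_Mapping"
    "HOL-Library.Extended_Nat"
begin

section \<open>Modules and projective dimension\<close>

text \<open>Only the additive group and the scalar multiplication of a module record matter;
  the fields \<open>mult\<close> and \<open>one\<close>, inherited from the ring record, are ignored by
  \<^const>\<open>Module.module\<close> and are left unspecified below whenever they have no meaning.\<close>

definition mod_hom ::
  "('a, 'r) ring_scheme \<Rightarrow> ('a, 'm, 'x) module_scheme \<Rightarrow> ('a, 'n, 'y) module_scheme \<Rightarrow> ('m \<Rightarrow> 'n) set"
  where "mod_hom R M N =
    {f \<in> carrier M \<rightarrow> carrier N.
      (\<forall>x\<in>carrier M. \<forall>y\<in>carrier M. f (x \<oplus>\<^bsub>M\<^esub> y) = f x \<oplus>\<^bsub>N\<^esub> f y) \<and>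
      (\<forall>r\<in>carrier R. \<forall>x\<in>carrier M. f (r \<odot>\<^bsub>M\<^esub> x) = r \<odot>\<^bsub>N\<^esub> f x)}"

definition mod_ker ::
  "('a, 'm, 'x) module_scheme \<Rightarrow> ('a, 'n, 'y) module_scheme \<Rightarrow> ('m \<Rightarrow> 'n) \<Rightarrow> 'm set"
  where "mod_ker M N f = {x \<in> carrier M. f x = \<zero>\<^bsub>N\<^esub>}"

definition free_module :: "('a, 'r) ring_scheme \<Rightarrow> 'b set \<Rightarrow> ('a, 'b \<Rightarrow> 'a) module"
  where "free_module R B =
    \<lparr>carrier = {v. (\<forall>b. v b \<in> carrier R) \<and> finite {b. v b \<noteq> \<zero>\<^bsub>R\<^esub>} \<and> {b. v b \<noteq> \<zero>\<^bsub>R\<^esub>} \<subseteq> B},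
     mult = undefined, one = undefined,
     zero = (\<lambda>b. \<zero>\<^bsub>R\<^esub>), add = (\<lambda>v w b. v b \<oplus>\<^bsub>R\<^esub> w b),
     smult = (\<lambda>r v b. r \<otimes>\<^bsub>R\<^esub> v b)\<rparr>"

definition quotient_module :: "('a, 'r) ring_scheme \<Rightarrow> 'a set \<Rightarrow> ('a, 'a set) module"
  where "quotient_module R I =
    \<lparr>carrier = carrier (R Quot I), mult = mult (R Quot I), one = one (R Quot I),
     zero = zero (R Quot I), add = add (R Quot I),
     smult = (\<lambda>r X. (I +>\<^bsub>R\<^esub> r) \<otimes>\<^bsub>R Quot I\<^esub> X)\<rparr>"

text \<open>The submodule \<open>\<aa>M\<close> of \<open>M\<close>.\<close>

definition ideal_smult :: "('a, 'r) ring_scheme \<Rightarrow> 'a set \<Rightarrow> ('a, 'm) module \<Rightarrow> 'm set"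
  where "ideal_smult R \<aa> M =
    \<Inter> {N. submodule N R M \<and> (\<forall>a\<in>\<aa>. \<forall>x\<in>carrier M. a \<odot>\<^bsub>M\<^esub> x \<in> N)}"

text \<open>A module is projective if it is a direct summand of a free module. Since a projective
  module is a direct summand of the free module on its own elements, it is no restriction that
  the basis \<open>B\<close> has the same type as the elements of \<open>P\<close>.\<close>

definition projective :: "('a, 'r) ring_scheme \<Rightarrow> ('a, 'm) module \<Rightarrow> bool"
  where "projective R P \<longleftrightarrow> Module.module R P \<and>
    (\<exists>(B :: 'm set) i p. i \<in> mod_hom R P (free_module R B) \<and> p \<in> mod_hom R (free_module R B) P \<and>
      (\<forall>x\<in>carrier P. p (i x) = x))"

text \<open>Exactness of \<open>\<dots> \<rightarrow> P 2 \<rightarrow> P 1 \<rightarrow> P 0 \<rightarrow> M \<rightarrow> 0\<close>, where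
  \<open>dd n : P (n + 1) \<rightarrow> P n\<close> and \<open>\<epsilon> : P 0 \<rightarrow> M\<close>.\<close>

definition resolution ::
  "('a, 'r) ring_scheme \<Rightarrow> ('a, 'n) module \<Rightarrow> (nat \<Rightarrow> ('a, 'm) module) \<Rightarrow>
    (nat \<Rightarrow> 'm \<Rightarrow> 'm) \<Rightarrow> ('m \<Rightarrow> 'n) \<Rightarrow> bool"
  where "resolution R M P dd \<epsilon> \<longleftrightarrow>
    (\<forall>n. Module.module R (P n)) \<and>
    (\<forall>n. dd n \<in> mod_hom R (P (Suc n)) (P n)) \<and>
    \<epsilon> \<in> mod_hom R (P 0) M \<and>
    \<epsilon> ` carrier (P 0) = carrier M \<and>
    dd 0 ` carrier (P 1) = mod_ker (P 0) M \<epsilon> \<and>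
    (\<forall>n. dd (Suc n) ` carrier (P (Suc (Suc n))) = mod_ker (P (Suc n)) (P n) (dd n))"

text \<open>The least length of a projective resolution, and \<open>\<infinity>\<close> if there is no resolution of
  finite length. The modules in the resolution have elements in \<open>nat \<Rightarrow> 'a\<close>, which up to
  isomorphism covers all countably generated projective modules. For \<open>R\<close> noetherian and \<open>M\<close>
  finitely generated (as in the case of a homogeneous quotient of a polynomial ring) this gives the usual projective dimension,
  as a resolution of minimal length can then be chosen with finitely generated modules.\<close>

definition proj_dim :: "('a, 'r) ring_scheme \<Rightarrow> ('a, 'm) module \<Rightarrow> enat"
  where "proj_dim R M =
    Inf {enat n | n. \<exists>(P :: nat \<Rightarrow> ('a, nat \<Rightarrow> 'a) module) dd \<epsilon>.
      (\<forall>i. projective R (P i)) \<and> resolution R M P dd \<epsilon> \<and> (\<forall>i>n. carrier (P i) = {\<zero>\<^bsub>P i\<^esub>})}"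


section \<open>The standard graded polynomial ring\<close>

text \<open>A monomial is an exponent vector; the variables are indexed by \<open>0, \<dots>, d - 1\<close>.\<close>

type_synonym 'k mpoly = "(nat \<Rightarrow>\<^sub>0 nat) \<Rightarrow>\<^sub>0 'k"

definition poly_ring :: "nat \<Rightarrow> 'k::field mpoly ring"
  where "poly_ring d =
    \<lparr>carrier = {p. \<forall>m\<in>Poly_Mapping.keys p. Poly_Mapping.keys m \<subseteq> {..<d}},
     mult = (*), one = 1, zero = 0, add = (+)\<rparr>"

definition var :: "nat \<Rightarrow> 'k::field mpoly"
  where "var i = Poly_Mapping.single (Poly_Mapping.single i 1) 1"

definition mdeg :: "(nat \<Rightarrow>\<^sub>0 nat) \<Rightarrow> nat"
  where "mdeg m = (\<Sum>i\<in>Poly_Mapping.keys m. Poly_Mapping.lookup m i)"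

text \<open>Membership in the component of degree \<open>e\<close>; in particular \<open>0\<close> is homogeneous of every
  degree and is the only homogeneous element of negative degree.\<close>

definition homogeneous :: "int \<Rightarrow> 'k::field mpoly \<Rightarrow> bool"
  where "homogeneous e p \<longleftrightarrow> (\<forall>m\<in>Poly_Mapping.keys p. int (mdeg m) = e)"

definition homogeneous_ideal :: "nat \<Rightarrow> 'k::field mpoly set \<Rightarrow> bool"
  where "homogeneous_ideal d I \<longleftrightarrow>
    (\<exists>H \<subseteq> {p \<in> carrier (poly_ring d). \<exists>e. homogeneous e p}. I = genideal (poly_ring d) H)"

definition irrelevant_ideal :: "nat \<Rightarrow> 'k::field mpoly set"
  where "irrelevant_ideal d = genideal (poly_ring d) (var ` {..<d})"


section \<open>Minimal graded free resolutions\<close>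

text \<open>A finitely generated graded free module \<open>\<Oplus>\<^sub>i S(-a\<^sub>i)\<close> is given by the list \<open>as\<close> of the
  degrees \<open>a\<^sub>i\<close> of its basis elements. The \<open>i\<close>-th coordinate of an element of degree \<open>e\<close> lies in
  \<open>S(-a\<^sub>i)\<^sub>e\<close>, that is, has degree \<open>e - a\<^sub>i\<close> in \<open>S\<close>.\<close>

definition gr_free :: "nat \<Rightarrow> int list \<Rightarrow> ('k::field mpoly, nat \<Rightarrow> 'k mpoly) module"
  where "gr_free d as = free_module (poly_ring d) {..<length as}"

definition gr_component :: "nat \<Rightarrow> int list \<Rightarrow> int \<Rightarrow> (nat \<Rightarrow> 'k::field mpoly) set"
  where "gr_component d as e =
    {v \<in> carrier (gr_free d as). \<forall>i<length as. homogeneous (e - as ! i) (v i)}"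

text \<open>\<open>sh a\<close> lists the degrees of the generators of \<open>F\<^sub>a\<close>, and \<open>dd a : F\<^bsub>a+1\<^esub> \<rightarrow> F\<^sub>a\<close>.
  The augmentation is the canonical projection \<open>F\<^sub>0 = S \<rightarrow> S/I\<close>. The modules
  \<open>F\<^sub>a\<close> with \<open>a\<close> larger than the length of the resolution are zero, i.e. \<open>sh a = []\<close>.\<close>

definition minimal_graded_free_resolution ::
  "nat \<Rightarrow> 'k::field mpoly set \<Rightarrow> (nat \<Rightarrow> int list) \<Rightarrow>
    (nat \<Rightarrow> (nat \<Rightarrow> 'k mpoly) \<Rightarrow> (nat \<Rightarrow> 'k mpoly)) \<Rightarrow> bool"
  where "minimal_graded_free_resolution d I sh dd \<longleftrightarrow>
    sh 0 = [0] \<and>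
    resolution (poly_ring d) (quotient_module (poly_ring d) I) (\<lambda>a. gr_free d (sh a)) dd
      (\<lambda>v. I +>\<^bsub>poly_ring d\<^esub> v 0) \<and>
    (\<forall>a e. dd a ` gr_component d (sh (Suc a)) e \<subseteq> gr_component d (sh a) e) \<and>
    (\<forall>a. dd a ` carrier (gr_free d (sh (Suc a)))
      \<subseteq> ideal_smult (poly_ring d) (irrelevant_ideal d) (gr_free d (sh a)))"

definition betti :: "(nat \<Rightarrow> int list) \<Rightarrow> nat \<Rightarrow> int \<Rightarrow> nat"
  where "betti sh a j = count_list (sh a) j"

definition min_shift :: "(nat \<Rightarrow> int list) \<Rightarrow> nat \<Rightarrow> int"
  where "min_shift sh a = Min {j. betti sh a j \<noteq> 0}"

definition max_shift :: "(nat \<Rightarrow> int list) \<Rightarrow> nat \<Rightarrow> int"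
  where "max_shift sh a = Max {j. betti sh a j \<noteq> 0}"

end

theory Submission
  imports Defs
begin

text \<open>Pick a nonzero homogeneous \<open>f \<in> I\<close> of degree \<open>t\<^sub>1\<close>; multiplication by \<open>f\<close> on the resolution is
  homotopic to zero through graded maps \<open>\<tau>\<^sub>i : F\<^sub>i \<rightarrow> F\<^bsub>i+1\<^esub>\<close> of degree \<open>t\<^sub>1\<close>. If
  \<open>t\<^sub>n > t\<^sub>1 + T\<^bsub>n-1\<^esub>\<close>, then \<open>F\<^sub>n\<close> vanishes in all degrees where \<open>\<tau>\<^bsub>n-1\<^esub>\<close> could take the generators of
  \<open>F\<^bsub>n-1\<^esub>\<close>, so \<open>\<tau>\<^bsub>n-1\<^esub> = 0\<close> and multiplication by \<open>f\<close> on \<open>F\<^bsub>n-1\<^esub>\<close> factors through the differential.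
  As \<open>f\<close> is a nonzerodivisor, \<open>F\<^bsub>n-1\<^esub> \<rightarrow> F\<^bsub>n-2\<^esub>\<close> is injective, and truncating the resolution there
  shows that the projective dimension is at most \<open>n - 1\<close>.\<close>

section \<open>Free modules\<close>

lemma free_module_module:
  assumes "cring R"
  shows "Module.module R (free_module R B)"
proof -
  interpret R: cring R by fact
  have add_closed: "x \<oplus>\<^bsub>free_module R B\<^esub> y \<in> carrier (free_module R B)"
    if "x \<in> carrier (free_module R B)" "y \<in> carrier (free_module R B)" for x y
  proof -
    have "{b. x b \<oplus>\<^bsub>R\<^esub> y b \<noteq> \<zero>\<^bsub>R\<^esub>} \<subseteq> {b. x b \<noteq> \<zero>\<^bsub>R\<^esub>} \<union> {b. y b \<noteq> \<zero>\<^bsub>R\<^esub>}"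
      by auto
    with that show ?thesis
      by (auto simp: free_module_def intro: finite_subset)
  qed
  show ?thesis
  proof (rule moduleI)
    show "abelian_group (free_module R B)"
    proof (rule abelian_groupI)
      fix x assume x: "x \<in> carrier (free_module R B)"
      define y where "y = (\<lambda>b. \<ominus>\<^bsub>R\<^esub> x b)"
      have "{b. y b \<noteq> \<zero>\<^bsub>R\<^esub>} \<subseteq> {b. x b \<noteq> \<zero>\<^bsub>R\<^esub>}"
        by (auto simp: y_def)
      with x have "y \<in> carrier (free_module R B)"
        by (auto simp: free_module_def y_def intro: finite_subset)
      moreover have "y \<oplus>\<^bsub>free_module R B\<^esub> x = \<zero>\<^bsub>free_module R B\<^esub>"
        using x by (auto simp: free_module_def y_def R.l_neg)
      ultimately show "\<exists>y\<in>carrier (free_module R B). y \<oplus>\<^bsub>free_module R B\<^esub> x = \<zero>\<^bsub>free_module R B\<^esub>"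
        by blast
    qed (fact add_closed | auto simp: free_module_def R.a_assoc R.a_comm R.a_lcomm)+
  next
    fix a x assume a: "a \<in> carrier R" and x: "x \<in> carrier (free_module R B)"
    have "{b. a \<otimes>\<^bsub>R\<^esub> x b \<noteq> \<zero>\<^bsub>R\<^esub>} \<subseteq> {b. x b \<noteq> \<zero>\<^bsub>R\<^esub>}"
      using a by auto
    with a x show "a \<odot>\<^bsub>free_module R B\<^esub> x \<in> carrier (free_module R B)"
      by (auto simp: free_module_def intro: finite_subset)
  qed (auto simp: free_module_def R.l_distr R.r_distr R.m_assoc assms)
qed

text \<open>\<open>projective\<close> wants a free module whose basis has the same type as the
  elements of the module, whereas \<open>B\<close> has its own type. So \<open>B\<close> is
  relabelled by its unit vectors \<open>u b\<close>; the relabelling \<open>i\<close> has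
  \<open>p\<close> as a left inverse. Distinctness of the unit vectors comes from \<open>1\<close>
  being nonzero.\<close>

lemma free_module_projective:
  fixes B :: "'b set"
  assumes "cring R" and "\<one>\<^bsub>R\<^esub> \<noteq> \<zero>\<^bsub>R\<^esub>"
  shows "projective R (free_module R B)"
proof -
  interpret R: cring R by fact
  define u where "u b = (\<lambda>c. if c = b then \<one>\<^bsub>R\<^esub> else \<zero>\<^bsub>R\<^esub>)" for b :: 'b
  have inj: "u b = u c \<longleftrightarrow> b = c" for b c
    using assms(2) by (auto simp: u_def fun_eq_iff)
  \<comment> \<open>The definite description inverts \<open>u\<close>, which is injective.\<close>
  define i where "i v = (\<lambda>w. if w \<in> u ` B then v (THE b. w = u b) else \<zero>\<^bsub>R\<^esub>)" for v
  define p where "p w = (\<lambda>b. if b \<in> B then w (u b) else \<zero>\<^bsub>R\<^esub>)" for w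
  have i_u [simp]: "b \<in> B \<Longrightarrow> i v (u b) = v b" for v b
    by (auto simp: i_def inj)
  have i_out: "w \<notin> u ` B \<Longrightarrow> i v w = \<zero>\<^bsub>R\<^esub>" for v w
    by (simp add: i_def)
  have i_eqI: "i v = w" if "\<And>b. b \<in> B \<Longrightarrow> v b = w (u b)" "\<And>x. x \<notin> u ` B \<Longrightarrow> w x = \<zero>\<^bsub>R\<^esub>" for v w
  proof
    fix x show "i v x = w x"
      using that by (cases "x \<in> u ` B") (auto simp: i_out)
  qed
  have "i \<in> mod_hom R (free_module R B) (free_module R (u ` B))"
  proof -
    have "i v \<in> carrier (free_module R (u ` B))" if v: "v \<in> carrier (free_module R B)" for v
    proof -
      have sub: "{w. i v w \<noteq> \<zero>\<^bsub>R\<^esub>} \<subseteq> u ` {b. v b \<noteq> \<zero>\<^bsub>R\<^esub>}"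
      proof
        fix w assume "w \<in> {w. i v w \<noteq> \<zero>\<^bsub>R\<^esub>}"
        then show "w \<in> u ` {b. v b \<noteq> \<zero>\<^bsub>R\<^esub>}"
          by (cases "w \<in> u ` B") (auto simp: i_out)
      qed
      have "finite {w. i v w \<noteq> \<zero>\<^bsub>R\<^esub>}"
        by (rule finite_subset[OF sub]) (use v in \<open>simp add: free_module_def\<close>)
      then show ?thesis
        using v sub by (auto simp: free_module_def i_def)
    qed
    moreover have "i (v \<oplus>\<^bsub>free_module R B\<^esub> w) = i v \<oplus>\<^bsub>free_module R (u ` B)\<^esub> i w" for v w
      by (rule i_eqI) (auto simp: free_module_def i_out)
    moreover have "i (r \<odot>\<^bsub>free_module R B\<^esub> v) = r \<odot>\<^bsub>free_module R (u ` B)\<^esub> i v"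
      if "r \<in> carrier R" for r v
      by (rule i_eqI) (use that in \<open>auto simp: free_module_def i_out\<close>)
    ultimately show ?thesis
      by (auto simp: mod_hom_def)
  qed
  moreover have "p \<in> mod_hom R (free_module R (u ` B)) (free_module R B)"
  proof -
    have "p w \<in> carrier (free_module R B)" if w: "w \<in> carrier (free_module R (u ` B))" for w
    proof -
      \<comment> \<open>The injective map \<open>u\<close> carries the support of \<open>p w\<close>
        into the finite support of \<open>w\<close>.\<close>
      have "u ` {b. p w b \<noteq> \<zero>\<^bsub>R\<^esub>} \<subseteq> {x. w x \<noteq> \<zero>\<^bsub>R\<^esub>}"
        by (auto simp: p_def split: if_splits)
      then have "finite (u ` {b. p w b \<noteq> \<zero>\<^bsub>R\<^esub>})"
        using w by (auto simp: free_module_def intro: finite_subset)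
      then have "finite {b. p w b \<noteq> \<zero>\<^bsub>R\<^esub>}"
        by (rule finite_imageD) (auto simp: inj_on_def inj)
      then show ?thesis
        using w by (auto simp: free_module_def p_def split: if_splits)
    qed
    moreover have "p (v \<oplus>\<^bsub>free_module R (u ` B)\<^esub> w) = p v \<oplus>\<^bsub>free_module R B\<^esub> p w" for v w
      by (auto simp: free_module_def p_def)
    moreover have "p (r \<odot>\<^bsub>free_module R (u ` B)\<^esub> v) = r \<odot>\<^bsub>free_module R B\<^esub> p v"
      if "r \<in> carrier R" for r v
      using that by (auto simp: free_module_def p_def)
    ultimately show ?thesis
      by (auto simp: mod_hom_def)
  qed
  moreover have "p (i v) = v" if "v \<in> carrier (free_module R B)" for v
  proof
    fix b show "p (i v) b = v b"
      using that by (cases "b \<in> B") (force simp: p_def free_module_def)+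
  qed
  ultimately show ?thesis
    unfolding projective_def using free_module_module[OF assms(1)] by blast
qed


section \<open>Homogeneous parts of polynomials\<close>

lemma mdeg_plus: "mdeg (m + n) = mdeg m + mdeg n"
proof -
  \<comment> \<open>The three degrees involve sums over different key sets; extending each by zeros
    to the common union lets them be added termwise.\<close>
  have *: "mdeg l = (\<Sum>i\<in>Poly_Mapping.keys m \<union> Poly_Mapping.keys n. Poly_Mapping.lookup l i)"
    if "Poly_Mapping.keys l \<subseteq> Poly_Mapping.keys m \<union> Poly_Mapping.keys n" for l
    unfolding mdeg_def by (rule sum.mono_neutral_left) (use that in \<open>auto simp: in_keys_iff\<close>)
  show ?thesis
    using Poly_Mapping.keys_add[of m n] by (simp add: * lookup_add sum.distrib)
qed

lemma homogeneous_zero [simp]: "homogeneous e 0"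
  by (simp add: homogeneous_def)

lemma homogeneous_one: "homogeneous 0 1"
  by (simp add: homogeneous_def mdeg_def)

lemma homogeneous_add: "homogeneous e p \<Longrightarrow> homogeneous e q \<Longrightarrow> homogeneous e (p + q)"
  using Poly_Mapping.keys_add[of p q] by (auto simp: homogeneous_def)

lemma homogeneous_diff: "homogeneous e p \<Longrightarrow> homogeneous e q \<Longrightarrow> homogeneous e (p - q)"
  using Poly_Mapping.keys_diff[of p q] by (auto simp: homogeneous_def)

lemma homogeneous_sum: "(\<And>j. j \<in> A \<Longrightarrow> homogeneous e (p j)) \<Longrightarrow> homogeneous e (\<Sum>j\<in>A. p j)"
  by (induction A rule: infinite_finite_induct) (auto intro: homogeneous_add)

lemma homogeneous_mult:
  assumes "homogeneous e p" "homogeneous e' q"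
  shows "homogeneous (e + e') (p * q)"
  using assms keys_mult[of p q] by (fastforce simp: homogeneous_def mdeg_plus)

lemma homogeneous_negative: "homogeneous e p \<Longrightarrow> e < 0 \<Longrightarrow> p = 0"
  by (force simp: homogeneous_def simp flip: keys_eq_empty)

section \<open>Projection of polynomials to a fixed degree\<close>

definition hpart :: "int \<Rightarrow> 'k::field mpoly \<Rightarrow> 'k mpoly"
  where "hpart e p = Poly_Mapping.mapp (\<lambda>m c. if int (mdeg m) = e then c else 0) p"

lemma lookup_hpart:
  "Poly_Mapping.lookup (hpart e p) m = (if int (mdeg m) = e then Poly_Mapping.lookup p m else 0)"
  by (auto simp: hpart_def lookup_mapp when_def in_keys_iff)

lemma keys_hpart: "Poly_Mapping.keys (hpart e p) = {m \<in> Poly_Mapping.keys p. int (mdeg m) = e}"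
  by (auto simp: in_keys_iff lookup_hpart split: if_splits)

lemma homogeneous_hpart: "homogeneous e (hpart e p)"
  by (simp add: homogeneous_def keys_hpart)

lemma hpart_add: "hpart e (p + q) = hpart e p + hpart e q"
  by (rule poly_mapping_eqI) (simp add: lookup_hpart lookup_add)

lemma hpart_sum: "hpart e (\<Sum>j\<in>A. p j) = (\<Sum>j\<in>A. hpart e (p j))"
proof -
  have "hpart e 0 = 0"
    by (rule poly_mapping_eqI) (simp add: lookup_hpart)
  then show ?thesis
    by (induction A rule: infinite_finite_induct) (auto simp: hpart_add)
qed

lemma hpart_homogeneous: "homogeneous e p \<Longrightarrow> hpart e p = p"
  by (rule poly_mapping_eqI) (auto simp: lookup_hpart homogeneous_def in_keys_iff)

text \<open>Every term of \<open>q\<close> has degree \<open>c\<close>, so the terms of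
  \<open>p\<close> outside degree \<open>e - c\<close>, collected in \<open>r\<close>, contribute
  nothing to degree \<open>e\<close> of the product.\<close>

lemma hpart_mult_homogeneous:
  assumes q: "homogeneous c q"
  shows "hpart e (p * q) = hpart (e - c) p * q"
proof -
  define r where "r = p - hpart (e - c) p"
  have r: "int (mdeg m) \<noteq> e - c" if "m \<in> Poly_Mapping.keys r" for m
    using that by (auto simp: r_def in_keys_iff lookup_minus lookup_hpart)
  have "Poly_Mapping.keys (hpart e (r * q)) = {}"
    using keys_mult[of r q] q r by (fastforce simp: keys_hpart homogeneous_def mdeg_plus)
  then have "hpart e (r * q) = 0"
    by simp
  moreover have "hpart e (hpart (e - c) p * q) = hpart (e - c) p * q"
    using homogeneous_mult[OF homogeneous_hpart q, of "e - c" p] by (simp add: hpart_homogeneous)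
  moreover have "p * q = hpart (e - c) p * q + r * q"
    by (simp add: r_def algebra_simps)
  ultimately show ?thesis
    by (simp add: hpart_add)
qed


section \<open>The polynomial ring\<close>

lemma poly_ring_simps [simp]:
  "mult (poly_ring d) = (*)" "one (poly_ring d) = 1" "zero (poly_ring d) = 0" "add (poly_ring d) = (+)"
  by (simp_all add: poly_ring_def)

lemma zero_in_poly_ring: "0 \<in> carrier (poly_ring d)"
  and one_in_poly_ring: "1 \<in> carrier (poly_ring d)"
  by (auto simp: poly_ring_def)

lemma
  assumes pq: "p \<in> carrier (poly_ring d)" "q \<in> carrier (poly_ring d)"
  shows add_in_poly_ring: "p + q \<in> carrier (poly_ring d)"
    and diff_in_poly_ring: "p - q \<in> carrier (poly_ring d)"
    and mult_in_poly_ring: "p * q \<in> carrier (poly_ring d)"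
proof -
  show "p + q \<in> carrier (poly_ring d)"
    using pq Poly_Mapping.keys_add[of p q] by (auto simp: poly_ring_def)
  show "p - q \<in> carrier (poly_ring d)"
    using pq Poly_Mapping.keys_diff[of p q] by (auto simp: poly_ring_def)
  have "Poly_Mapping.keys m \<subseteq> {..<d}" if "m \<in> Poly_Mapping.keys (p * q)" for m
  proof -
    from that obtain a b where "m = a + b" "a \<in> Poly_Mapping.keys p" "b \<in> Poly_Mapping.keys q"
      using keys_mult[of p q] by blast
    with pq show ?thesis
      using Poly_Mapping.keys_add[of a b] by (fastforce simp: poly_ring_def)
  qed
  then show "p * q \<in> carrier (poly_ring d)"
    by (simp add: poly_ring_def)
qed

lemmas poly_ring_closed =
  zero_in_poly_ring one_in_poly_ring add_in_poly_ring diff_in_poly_ring mult_in_poly_ring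

lemma sum_in_poly_ring:
  "(\<And>j. j \<in> A \<Longrightarrow> p j \<in> carrier (poly_ring d)) \<Longrightarrow> (\<Sum>j\<in>A. p j) \<in> carrier (poly_ring d)"
  by (induction A rule: infinite_finite_induct) (auto intro: poly_ring_closed)

lemma hpart_in_poly_ring: "p \<in> carrier (poly_ring d) \<Longrightarrow> hpart e p \<in> carrier (poly_ring d)"
  by (auto simp: poly_ring_def keys_hpart)

lemma poly_ring_cring: "cring (poly_ring d :: 'k::field mpoly ring)"
proof (rule cringI)
  show "abelian_group (poly_ring d :: 'k mpoly ring)"
  proof (rule abelian_groupI)
    fix x :: "'k mpoly" assume "x \<in> carrier (poly_ring d)"
    then have "- x \<in> carrier (poly_ring d)"
      using diff_in_poly_ring[OF zero_in_poly_ring] by fastforce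
    then show "\<exists>y\<in>carrier (poly_ring d). y \<oplus>\<^bsub>poly_ring d\<^esub> x = \<zero>\<^bsub>poly_ring d\<^esub>"
      by (intro bexI[of _ "- x"]) auto
  qed (auto simp: add_ac intro: poly_ring_closed)
  show "Group.comm_monoid (poly_ring d :: 'k mpoly ring)"
    by (rule comm_monoidI) (auto simp: mult_ac intro: poly_ring_closed)
qed (auto simp: algebra_simps)

section \<open>Constant terms and the irrelevant ideal\<close>

lemma coeff0_mult:
  fixes p q :: "'k::field mpoly"
  assumes "Poly_Mapping.lookup p 0 = 0"
  shows "Poly_Mapping.lookup (p * q) 0 = 0"
proof (rule ccontr)
  assume "Poly_Mapping.lookup (p * q) 0 \<noteq> 0"
  then have "0 \<in> Poly_Mapping.keys (p * q)"
    by (simp add: in_keys_iff)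
  then obtain a b where ab: "0 = a + b" "a \<in> Poly_Mapping.keys p"
    using keys_mult[of p q] by blast
  from ab(1) have "a = 0"
    by (metis add_eq_0_iff_both_eq_0 lookup_add lookup_zero poly_mapping_eqI)
  with ab(2) assms show False
    by (simp add: in_keys_iff)
qed

text \<open>The polynomials without constant term form an ideal containing all variables, hence
  containing the ideal they generate. This makes minimality testable on constant terms.\<close>

lemma irrelevant_ideal_coeff0:
  assumes "a \<in> irrelevant_ideal d"
  shows "a \<in> carrier (poly_ring d) \<and> Poly_Mapping.lookup a 0 = 0"
proof -
  interpret S: cring "poly_ring d" by (rule poly_ring_cring)
  define J :: "'a mpoly set" where "J = {a \<in> carrier (poly_ring d). Poly_Mapping.lookup a 0 = 0}"
  have "subgroup J (add_monoid (poly_ring d))"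
  proof (rule S.add.subgroupI)
    fix x assume x: "x \<in> J"
    then have "- x \<in> carrier (poly_ring d)"
      using diff_in_poly_ring[OF zero_in_poly_ring, of x] by (auto simp: J_def)
    moreover have "\<ominus>\<^bsub>poly_ring d\<^esub> x = - x"
      by (rule S.minus_equality) (use x calculation in \<open>auto simp: J_def\<close>)
    ultimately show "\<ominus>\<^bsub>poly_ring d\<^esub> x \<in> J"
      using x by (auto simp: J_def)
  qed (auto simp: J_def lookup_add intro: poly_ring_closed)
  then have "ideal J (poly_ring d)"
    by (intro idealI S.ring_axioms)
      (auto simp: J_def coeff0_mult mult.commute[of _ "_ :: 'a mpoly"] intro: poly_ring_closed)
  moreover have "var ` {..<d} \<subseteq> J"
  proof -
    have "Poly_Mapping.single i (1::nat) \<noteq> 0" for i :: nat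
      by (metis lookup_single_eq lookup_zero one_neq_zero)
    then show ?thesis
      by (auto simp: J_def var_def poly_ring_def lookup_single when_def split: if_splits)
  qed
  ultimately have "irrelevant_ideal d \<subseteq> J"
    unfolding irrelevant_ideal_def by (rule S.genideal_minimal)
  with assms show ?thesis
    by (auto simp: J_def)
qed


section \<open>Graded free modules\<close>

lemma gr_free_simps [simp]:
  "add (gr_free d as) v w = (\<lambda>i. v i + w i)"
  "smult (gr_free d as) r v = (\<lambda>i. r * v i)"
  "zero (gr_free d as) = (\<lambda>i. 0)"
  by (simp_all add: gr_free_def free_module_def)

lemma gr_free_carrier:
  "v \<in> carrier (gr_free d as) \<longleftrightarrow> (\<forall>i. v i \<in> carrier (poly_ring d)) \<and> (\<forall>i\<ge>length as. v i = 0)"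
proof -
  have "finite {i. v i \<noteq> 0}" if "\<forall>i\<ge>length as. v i = 0"
    by (rule finite_subset[of _ "{..<length as}"]) (use that in \<open>auto simp: not_le[symmetric]\<close>)
  then show ?thesis
    by (fastforce simp: gr_free_def free_module_def not_le[symmetric])
qed

lemma gr_free_Nil: "carrier (gr_free d []) = {\<lambda>i. 0}"
  by (auto simp: gr_free_carrier poly_ring_closed)

lemma gr_free_module: "Module.module (poly_ring d) (gr_free d as)"
  unfolding gr_free_def by (rule free_module_module[OF poly_ring_cring])

lemma gr_free_projective: "projective (poly_ring d) (gr_free d as)"
  unfolding gr_free_def by (rule free_module_projective[OF poly_ring_cring]) simp

section \<open>Linear maps between free modules in terms of bases\<close>

definition unit_vec :: "nat \<Rightarrow> nat \<Rightarrow> 'k::field mpoly"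
  where "unit_vec j = (\<lambda>i. if i = j then 1 else 0)"

definition lincomb :: "nat \<Rightarrow> (nat \<Rightarrow> nat \<Rightarrow> 'k::field mpoly) \<Rightarrow> (nat \<Rightarrow> 'k mpoly) \<Rightarrow> nat \<Rightarrow> 'k mpoly"
  where "lincomb n y v = (\<lambda>i. \<Sum>j<n. v j * y j i)"

abbreviation gr_hom :: "nat \<Rightarrow> int list \<Rightarrow> int list \<Rightarrow> ((nat \<Rightarrow> 'k::field mpoly) \<Rightarrow> nat \<Rightarrow> 'k mpoly) set"
  where "gr_hom d as bs \<equiv> mod_hom (poly_ring d) (gr_free d as) (gr_free d bs)"

lemma gr_homD:
  assumes "g \<in> gr_hom d as bs"
  shows "v \<in> carrier (gr_free d as) \<Longrightarrow> g v \<in> carrier (gr_free d bs)"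
    and "v \<in> carrier (gr_free d as) \<Longrightarrow> w \<in> carrier (gr_free d as) \<Longrightarrow> g (\<lambda>i. v i + w i) = (\<lambda>i. g v i + g w i)"
    and "r \<in> carrier (poly_ring d) \<Longrightarrow> v \<in> carrier (gr_free d as) \<Longrightarrow> g (\<lambda>i. r * v i) = (\<lambda>i. r * g v i)"
  using assms by (auto simp: mod_hom_def)

lemma gr_homI:
  assumes "\<And>v. v \<in> carrier (gr_free d as) \<Longrightarrow> g v \<in> carrier (gr_free d bs)"
    and "\<And>v w. v \<in> carrier (gr_free d as) \<Longrightarrow> w \<in> carrier (gr_free d as) \<Longrightarrow> g (\<lambda>i. v i + w i) = (\<lambda>i. g v i + g w i)"
    and "\<And>r v. r \<in> carrier (poly_ring d) \<Longrightarrow> v \<in> carrier (gr_free d as) \<Longrightarrow> g (\<lambda>i. r * v i) = (\<lambda>i. r * g v i)"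
  shows "g \<in> gr_hom d as bs"
  using assms by (auto simp: mod_hom_def)

lemma gr_hom_zero:
  assumes "g \<in> gr_hom d as bs"
  shows "g (\<lambda>i. 0) = (\<lambda>i. 0)"
  using gr_homD(3)[OF assms, of 0 "\<lambda>i. 0"] by (simp add: poly_ring_closed gr_free_carrier)

lemma unit_vec_carrier: "j < length as \<Longrightarrow> unit_vec j \<in> carrier (gr_free d as)"
  by (auto simp: gr_free_carrier unit_vec_def poly_ring_closed)

lemma unit_vec_component: "j < length as \<Longrightarrow> unit_vec j \<in> gr_component d as (as ! j)"
  by (auto simp: gr_component_def unit_vec_carrier) (auto simp: unit_vec_def homogeneous_one)

lemma lincomb_unit_vec: "j < n \<Longrightarrow> lincomb n y (unit_vec j) = y j"
  by (rule ext) (simp add: lincomb_def unit_vec_def if_distrib[of "\<lambda>x. x * _"] sum.delta cong: if_cong)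

lemma lincomb_gr_hom:
  assumes "\<And>j. j < length as \<Longrightarrow> y j \<in> carrier (gr_free d bs)"
  shows "lincomb (length as) y \<in> gr_hom d as bs"
  by (rule gr_homI)
    (use assms in \<open>auto simp: lincomb_def gr_free_carrier algebra_simps sum.distrib sum_distrib_left
      intro!: sum_in_poly_ring mult_in_poly_ring\<close>)

text \<open>Induction on the number \<open>k\<close> of leading coordinates of \<open>v\<close> that
  are kept: each step adds a single scaled basis vector, to which additivity and compatibility with
  scalars apply.\<close>

lemma gr_hom_lincomb:
  assumes g: "g \<in> gr_hom d as bs" and v: "v \<in> carrier (gr_free d as)"
  shows "g v = lincomb (length as) (\<lambda>j. g (unit_vec j)) v"
proof -
  have "g (\<lambda>i. if i < k then v i else 0) = lincomb k (\<lambda>j. g (unit_vec j)) v" if "k \<le> length as" for k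
    using that
  proof (induction k)
    case 0
    then show ?case using gr_hom_zero[OF g] by (simp add: lincomb_def)
  next
    case (Suc k)
    have trunc: "(\<lambda>i. if i < k then v i else 0) \<in> carrier (gr_free d as)"
      using v by (auto simp: gr_free_carrier poly_ring_closed)
    have vk: "v k \<in> carrier (poly_ring d)"
      using v by (simp add: gr_free_carrier)
    have uk: "unit_vec k \<in> carrier (gr_free d as)"
      using Suc.prems by (simp add: unit_vec_carrier)
    then have vku: "(\<lambda>i. v k * unit_vec k i) \<in> carrier (gr_free d as)"
      using vk by (auto simp: gr_free_carrier poly_ring_closed)
    have "(\<lambda>i. if i < Suc k then v i else 0) = (\<lambda>i. (if i < k then v i else 0) + v k * unit_vec k i)"
      by (auto simp: unit_vec_def less_Suc_eq)
    with Suc show ?case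
      using gr_homD(2)[OF g trunc vku] gr_homD(3)[OF g vk uk] by (simp add: lincomb_def)
  qed
  from this[of "length as"] have "g (\<lambda>i. if i < length as then v i else 0) = lincomb (length as) (\<lambda>j. g (unit_vec j)) v"
    by simp
  moreover have "(\<lambda>i. if i < length as then v i else 0) = v"
    using v by (auto simp: gr_free_carrier)
  ultimately show ?thesis by simp
qed

lemma gr_hom_eqI:
  assumes "g \<in> gr_hom d as bs" "h \<in> gr_hom d as bs"
    and "\<And>j. j < length as \<Longrightarrow> g (unit_vec j) = h (unit_vec j)"
    and "v \<in> carrier (gr_free d as)"
  shows "g v = h v"
  using assms by (simp add: gr_hom_lincomb[of _ d as bs] lincomb_def)

lemma gr_hom_comp:
  assumes "g \<in> gr_hom d as bs" "h \<in> gr_hom d bs cs"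
  shows "(\<lambda>v. h (g v)) \<in> gr_hom d as cs"
  by (rule gr_homI) (simp_all add: gr_homD[OF assms(1)] gr_homD[OF assms(2)])

lemma gr_hom_scale:
  assumes "f \<in> carrier (poly_ring d)"
  shows "(\<lambda>v i. f * v i) \<in> gr_hom d as as"
  by (rule gr_homI) (use assms in \<open>auto simp: gr_free_carrier algebra_simps poly_ring_closed\<close>)

lemma gr_hom_diff:
  assumes "g \<in> gr_hom d as bs" "h \<in> gr_hom d as bs"
  shows "(\<lambda>v i. g v i - h v i) \<in> gr_hom d as bs"
proof (rule gr_homI)
  fix v :: "nat \<Rightarrow> 'a mpoly" assume "v \<in> carrier (gr_free d as)"
  then have "g v \<in> carrier (gr_free d bs)" "h v \<in> carrier (gr_free d bs)"
    using assms by (auto intro: gr_homD)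
  then show "(\<lambda>i. g v i - h v i) \<in> carrier (gr_free d bs)"
    by (auto simp: gr_free_carrier poly_ring_closed)
qed (simp_all add: gr_homD[OF assms(1)] gr_homD[OF assms(2)] algebra_simps)

section \<open>Projection to graded components and lifting of graded maps\<close>

definition vpart :: "int list \<Rightarrow> int \<Rightarrow> (nat \<Rightarrow> 'k::field mpoly) \<Rightarrow> nat \<Rightarrow> 'k mpoly"
  where "vpart as e v = (\<lambda>i. if i < length as then hpart (e - as ! i) (v i) else 0)"

lemma vpart_component: "v \<in> carrier (gr_free d as) \<Longrightarrow> vpart as e v \<in> gr_component d as e"
  by (auto simp: gr_component_def vpart_def gr_free_carrier homogeneous_hpart hpart_in_poly_ring zero_in_poly_ring)

lemma vpart_of_component: "v \<in> gr_component d as e \<Longrightarrow> vpart as e v = v"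
  by (rule ext) (auto simp: gr_component_def vpart_def gr_free_carrier hpart_homogeneous)

lemma gr_component_carrier: "v \<in> gr_component d as e \<Longrightarrow> v \<in> carrier (gr_free d as)"
  by (simp add: gr_component_def)

text \<open>Each coordinate would have negative degree in the polynomial ring. This is how a
  comparison of shifts forces an element to vanish.\<close>

lemma gr_component_eq_zero:
  assumes "v \<in> gr_component d as e" and "\<And>i. i < length as \<Longrightarrow> e < as ! i"
  shows "v = (\<lambda>i. 0)"
proof
  fix i
  show "v i = 0"
  proof (cases "i < length as")
    case True
    then have "homogeneous (e - as ! i) (v i)"
      using assms(1) by (simp add: gr_component_def)
    then show ?thesis
      using assms(2)[OF True] by (auto intro: homogeneous_negative)
  next
    case False
    then show ?thesis
      using gr_component_carrier[OF assms(1)] by (simp add: gr_free_carrier)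
  qed
qed

lemma gr_component_diff:
  "v \<in> gr_component d as e \<Longrightarrow> w \<in> gr_component d as e \<Longrightarrow> (\<lambda>i. v i - w i) \<in> gr_component d as e"
  by (auto simp: gr_component_def gr_free_carrier poly_ring_closed intro: homogeneous_diff)

lemma gr_component_scale:
  assumes "f \<in> carrier (poly_ring d)" "homogeneous t f" "v \<in> gr_component d as e"
  shows "(\<lambda>i. f * v i) \<in> gr_component d as (e + t)"
proof -
  have "homogeneous (e + t - as ! i) (f * v i)" if "i < length as" for i
    using homogeneous_mult[of t f "e - as ! i" "v i"] assms that
    by (simp add: gr_component_def algebra_simps)
  with assms show ?thesis
    by (auto simp: gr_component_def gr_free_carrier poly_ring_closed)
qed

lemma lincomb_component:
  assumes y: "\<And>j. j < length as \<Longrightarrow> y j \<in> gr_component d bs (as ! j + t)"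
    and v: "v \<in> gr_component d as e"
  shows "lincomb (length as) y v \<in> gr_component d bs (e + t)"
proof -
  have "lincomb (length as) y v \<in> carrier (gr_free d bs)"
    by (rule gr_homD(1)[OF lincomb_gr_hom]) (use y v in \<open>auto intro: gr_component_carrier\<close>)
  moreover have "homogeneous (e + t - bs ! i) (lincomb (length as) y v i)" if i: "i < length bs" for i
    unfolding lincomb_def
  proof (rule homogeneous_sum)
    fix j assume "j \<in> {..<length as}"
    then have "homogeneous ((e - as ! j) + (as ! j + t - bs ! i)) (v j * y j i)"
      using y v i by (intro homogeneous_mult) (auto simp: gr_component_def)
    moreover have "(e - as ! j) + (as ! j + t - bs ! i) = e + t - bs ! i"
      by simp
    ultimately show "homogeneous (e + t - bs ! i) (v j * y j i)"
      by (simp only:)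
  qed
  ultimately show ?thesis
    by (simp add: gr_component_def)
qed

text \<open>The matrix of \<open>g\<close> has homogeneous entries: entry \<open>i\<close> of
  \<open>g (unit_vec j)\<close> has degree \<open>as ! j - bs ! i\<close>. So degree
  \<open>e - bs ! i\<close> of each product comes exactly from degree \<open>e - as ! j\<close> of
  \<open>v j\<close>.\<close>

lemma gr_hom_vpart:
  assumes g: "g \<in> gr_hom d as bs" "\<And>e. g ` gr_component d as e \<subseteq> gr_component d bs e"
    and v: "v \<in> carrier (gr_free d as)"
  shows "vpart bs e (g v) = g (vpart as e v)"
proof
  fix i
  have gu: "g (unit_vec j) \<in> gr_component d bs (as ! j)" if "j < length as" for j
    using g(2) unit_vec_component[OF that, of d] by blast
  have *: "g (vpart as e v) = lincomb (length as) (\<lambda>j. g (unit_vec j)) (vpart as e v)"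
    "g v = lincomb (length as) (\<lambda>j. g (unit_vec j)) v"
    using gr_hom_lincomb[OF g(1)] v gr_component_carrier[OF vpart_component[OF v]] by blast+
  show "vpart bs e (g v) i = g (vpart as e v) i"
  proof (cases "i < length bs")
    case True
    have "hpart (e - bs ! i) (v j * g (unit_vec j) i) = hpart (e - as ! j) (v j) * g (unit_vec j) i"
      if "j < length as" for j
      using hpart_mult_homogeneous[of "as ! j - bs ! i" "g (unit_vec j) i" "e - bs ! i" "v j"] gu[OF that] True
      by (simp add: gr_component_def)
    with True show ?thesis
      unfolding * by (simp add: vpart_def lincomb_def hpart_sum)
  next
    case False
    with gr_homD(1)[OF g(1) gr_component_carrier[OF vpart_component[OF v]]] show ?thesis
      by (simp add: vpart_def gr_free_carrier)
  qed
qed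

text \<open>Take any preimage and project it to degree \<open>e\<close>; the projection commutes
  with \<open>g\<close> and fixes \<open>y\<close>.\<close>

lemma gr_hom_homogeneous_preimage:
  assumes "g \<in> gr_hom d as bs" "\<And>e. g ` gr_component d as e \<subseteq> gr_component d bs e"
    and "y \<in> gr_component d bs e" "y \<in> g ` carrier (gr_free d as)"
  shows "\<exists>x\<in>gr_component d as e. g x = y"
proof -
  obtain v where v: "v \<in> carrier (gr_free d as)" "y = g v"
    using assms(4) by blast
  have "g (vpart as e v) = vpart bs e y"
    using gr_hom_vpart[OF assms(1,2) v(1)] v(2) by simp
  also have "\<dots> = y"
    using assms(3) by (rule vpart_of_component)
  finally show ?thesis
    using vpart_component[OF v(1)] by blast
qed

text \<open>Freeness of the source: choose homogeneous preimages of the images of the basis vectors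
  and extend linearly. Choosing them in degree \<open>as ! j + t\<close> gives the lift degree
  \<open>t\<close>.\<close>

lemma gr_hom_lift:
  assumes g: "g \<in> gr_hom d cs bs" "\<And>e. g ` gr_component d cs e \<subseteq> gr_component d bs e"
    and h: "h \<in> gr_hom d as bs" "\<And>e. h ` gr_component d as e \<subseteq> gr_component d bs (e + t)"
    and img: "h ` carrier (gr_free d as) \<subseteq> g ` carrier (gr_free d cs)"
  shows "\<exists>\<tau>\<in>gr_hom d as cs. (\<forall>e. \<tau> ` gr_component d as e \<subseteq> gr_component d cs (e + t)) \<and>
    (\<forall>x\<in>carrier (gr_free d as). g (\<tau> x) = h x)"
proof -
  have "\<exists>y\<in>gr_component d cs (as ! j + t). g y = h (unit_vec j)" if "j < length as" for j
    using h(2) img unit_vec_component[OF that, of d] unit_vec_carrier[OF that, of d]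
    by (intro gr_hom_homogeneous_preimage[OF g]) blast+
  then obtain y where y: "\<And>j. j < length as \<Longrightarrow> y j \<in> gr_component d cs (as ! j + t)"
    "\<And>j. j < length as \<Longrightarrow> g (y j) = h (unit_vec j)"
    by metis
  have \<tau>: "lincomb (length as) y \<in> gr_hom d as cs"
    using y(1) by (intro lincomb_gr_hom) (auto intro: gr_component_carrier)
  have "g (lincomb (length as) y x) = h x" if "x \<in> carrier (gr_free d as)" for x
    by (rule gr_hom_eqI[OF gr_hom_comp[OF \<tau> g(1)] h(1) _ that]) (simp add: lincomb_unit_vec y(2))
  with \<tau> show ?thesis
    using lincomb_component[OF y(1)] by blast
qed


section \<open>Minimal graded free resolutions\<close>

text \<open>If \<open>dd k\<close> has zero image, then the map out of \<open>F_k\<close> is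
  injective, so everything above \<open>F_k\<close> can be cut off without losing exactness.\<close>

lemma proj_dim_le_truncation:
  assumes res: "resolution (poly_ring d) M (\<lambda>a. gr_free d (sh a)) dd \<epsilon>"
    and zero: "dd k ` carrier (gr_free d (sh (Suc k))) = {\<lambda>i. 0}"
  shows "proj_dim (poly_ring d) M \<le> enat k"
proof -
  \<comment> \<open>\<open>F_k\<close> survives, but \<open>dd k\<close> starts in
    \<open>F_(k+1)\<close> and must become zero; hence the bound \<open>a \<le> k\<close> for the
    modules and \<open>a < k\<close> for the maps.\<close>
  define sh' where "sh' a = (if a \<le> k then sh a else [])" for a
  define dd' where "dd' a = (if a < k then dd a else (\<lambda>v i. 0))" for a
  note res = res[unfolded resolution_def]
  have hom: "dd' a \<in> gr_hom d (sh' (Suc a)) (sh' a)" for a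
    using res by (auto simp: sh'_def dd'_def mod_hom_def gr_free_carrier zero_in_poly_ring)
  \<comment> \<open>For \<open>a = k\<close> the source has become zero, and the two images agree
    because of the assumption \<open>zero\<close>.\<close>
  have img: "dd' a ` carrier (gr_free d (sh' (Suc a))) = dd a ` carrier (gr_free d (sh (Suc a)))" if "a \<le> k" for a
    using that zero by (auto simp: dd'_def sh'_def gr_free_Nil)
  have exact: "dd' (Suc a) ` carrier (gr_free d (sh' (Suc (Suc a))))
      = mod_ker (gr_free d (sh' (Suc a))) (gr_free d (sh' a)) (dd' a)" for a
  proof (cases "Suc a \<le> k")
    case True
    then show ?thesis
      using res by (simp add: img) (simp add: sh'_def dd'_def)
  next
    case False
    then show ?thesis
      by (auto simp: sh'_def dd'_def gr_free_Nil mod_ker_def)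
  qed
  have "resolution (poly_ring d) M (\<lambda>a. gr_free d (sh' a)) dd' \<epsilon>"
    unfolding resolution_def using hom exact res img[of 0] by (simp add: gr_free_module) (simp add: sh'_def)
  moreover have "\<forall>i>k. carrier (gr_free d (sh' i)) = {\<zero>\<^bsub>gr_free d (sh' i)\<^esub>}"
    by (simp add: sh'_def gr_free_Nil)
  ultimately show ?thesis
    unfolding proj_dim_def
    by (intro Inf_lower CollectI exI[of _ k] exI[of _ "\<lambda>a. gr_free d (sh' a)"] exI[of _ dd'] exI[of _ \<epsilon>] conjI)
      (simp_all add: gr_free_projective)
qed

text \<open>The vectors whose coordinates all lack a constant term form a submodule that contains
  every product of an element of the irrelevant ideal with a vector.\<close>

lemma ideal_smult_irrelevant_coeff0:
  assumes "v \<in> ideal_smult (poly_ring d) (irrelevant_ideal d) (gr_free d as)"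
  shows "Poly_Mapping.lookup (v i) 0 = 0"
proof -
  interpret F: Module.module "poly_ring d" "gr_free d as" by (rule gr_free_module)
  define N :: "(nat \<Rightarrow> 'a mpoly) set" where "N = {v \<in> carrier (gr_free d as). \<forall>i. Poly_Mapping.lookup (v i) 0 = 0}"
  have N: "(\<lambda>i. a * x i) \<in> N"
    if "a \<in> carrier (poly_ring d)" "x \<in> carrier (gr_free d as)" "Poly_Mapping.lookup a 0 = 0 \<or> x \<in> N" for a x
    using that coeff0_mult[of a "x _"] coeff0_mult[of "x _" a]
    by (auto simp: N_def gr_free_carrier mult.commute[of _ a] intro: mult_in_poly_ring)
  have "submodule N (poly_ring d) (gr_free d as)"
  proof (rule F.submoduleI)
    fix x assume x: "x \<in> N"
    \<comment> \<open>Closure under negation is reduced to multiplication by the scalar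
      \<open>- 1\<close>.\<close>
    have m: "- 1 \<in> carrier (poly_ring d)"
      using diff_in_poly_ring[OF zero_in_poly_ring one_in_poly_ring] by simp
    have "(\<lambda>i. - 1 * x i) \<in> N"
      using N[OF m] x by (auto simp: N_def)
    moreover have "\<ominus>\<^bsub>gr_free d as\<^esub> x = (\<lambda>i. - 1 * x i)"
      by (rule F.M.minus_equality) (use x calculation in \<open>auto simp: N_def\<close>)
    ultimately show "\<ominus>\<^bsub>gr_free d as\<^esub> x \<in> N"
      by simp
  qed (use N in \<open>auto simp: N_def lookup_add gr_free_carrier poly_ring_closed\<close>)
  moreover have "\<forall>a\<in>irrelevant_ideal d. \<forall>x\<in>carrier (gr_free d as). a \<odot>\<^bsub>gr_free d as\<^esub> x \<in> N"
    using N irrelevant_ideal_coeff0 by auto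
  ultimately have "v \<in> N"
    using assms by (auto simp: ideal_smult_def)
  then show ?thesis
    by (simp add: N_def)
qed

section \<open>Minimal and maximal shifts\<close>

lemma shift_set: "{j. betti sh a j \<noteq> 0} = set (sh a)"
  by (auto simp: betti_def count_list_0_iff)

lemma min_shift_le: "i < length (sh a) \<Longrightarrow> min_shift sh a \<le> sh a ! i"
  unfolding min_shift_def shift_set by (intro Min_le) auto

lemma max_shift_ge: "i < length (sh a) \<Longrightarrow> sh a ! i \<le> max_shift sh a"
  unfolding max_shift_def shift_set by (intro Max_ge) auto

lemma min_shift_attained:
  assumes "sh a \<noteq> []"
  obtains i where "i < length (sh a)" "sh a ! i = min_shift sh a"
proof -
  have "min_shift sh a \<in> set (sh a)"
    unfolding min_shift_def shift_set using assms by (intro Min_in) auto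
  then show thesis
    using that by (auto simp: in_set_conv_nth)
qed

section \<open>Exactness, minimality and the homotopy for a resolution of a quotient ring\<close>

locale quotient_resolution =
  fixes d :: nat and I :: "'k::field mpoly set" and sh :: "nat \<Rightarrow> int list"
    and dd :: "nat \<Rightarrow> (nat \<Rightarrow> 'k mpoly) \<Rightarrow> (nat \<Rightarrow> 'k mpoly)"
  assumes I: "ideal I (poly_ring d)"
    and mgfr: "minimal_graded_free_resolution d I sh dd"
begin

abbreviation F :: "nat \<Rightarrow> (nat \<Rightarrow> 'k mpoly) set"
  where "F a \<equiv> carrier (gr_free d (sh a))"

lemma resolution:
  "resolution (poly_ring d) (quotient_module (poly_ring d) I) (\<lambda>a. gr_free d (sh a)) dd
    (\<lambda>v. I +>\<^bsub>poly_ring d\<^esub> v 0)"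
  using mgfr by (simp add: minimal_graded_free_resolution_def)

lemma sh_0: "sh 0 = [0]"
  using mgfr by (simp add: minimal_graded_free_resolution_def)

lemma dd_hom: "dd a \<in> gr_hom d (sh (Suc a)) (sh a)"
  using resolution by (simp add: resolution_def)

lemma dd_graded: "dd a ` gr_component d (sh (Suc a)) e \<subseteq> gr_component d (sh a) e"
  using mgfr by (simp add: minimal_graded_free_resolution_def)

lemma exact: "x \<in> dd (Suc a) ` F (Suc (Suc a)) \<longleftrightarrow> x \<in> F (Suc a) \<and> dd a x = (\<lambda>i. 0)"
  using resolution by (auto simp: resolution_def mod_ker_def)

text \<open>Exactness at \<open>F_0\<close>: the zero of the quotient is the coset \<open>I\<close>
  itself, and a coset equals \<open>I\<close> exactly when its representative lies in
  \<open>I\<close>.\<close>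

lemma exact_0: "x \<in> dd 0 ` F 1 \<longleftrightarrow> x \<in> F 0 \<and> x 0 \<in> I"
proof -
  interpret I: ideal I "poly_ring d" by (rule I)
  have sub: "subgroup I (add_monoid (poly_ring d))"
    by (rule I.a_subgroup)
  have "I +>\<^bsub>poly_ring d\<^esub> p = I \<longleftrightarrow> p \<in> I" if "p \<in> carrier (poly_ring d)" for p
    using I.a_coset_join1[OF _ that sub] I.a_coset_join2[OF that sub] by blast
  moreover have "x 0 \<in> carrier (poly_ring d)" if "x \<in> F 0"
    using that by (simp add: gr_free_carrier)
  moreover have "dd 0 ` F 1 = {x \<in> F 0. I +>\<^bsub>poly_ring d\<^esub> x 0 = I}"
    using resolution by (simp add: resolution_def mod_ker_def quotient_module_def FactRing_def)
  ultimately show ?thesis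
    by blast
qed

text \<open>A basis vector in the kernel would be a boundary by exactness, so by minimality its
  coordinates would have no constant term; but one of them is \<open>1\<close>.\<close>

lemma dd_unit_vec_nonzero:
  assumes "j < length (sh (Suc a))"
  shows "dd a (unit_vec j) \<noteq> (\<lambda>i. 0)"
proof
  assume "dd a (unit_vec j) = (\<lambda>i. 0)"
  then have "unit_vec j \<in> dd (Suc a) ` F (Suc (Suc a))"
    using exact unit_vec_carrier[OF assms] by blast
  then have "(unit_vec j :: nat \<Rightarrow> 'k mpoly)
      \<in> ideal_smult (poly_ring d) (irrelevant_ideal d) (gr_free d (sh (Suc a)))"
    using mgfr unfolding minimal_graded_free_resolution_def by blast
  from ideal_smult_irrelevant_coeff0[OF this, of j] show False
    by (simp add: unit_vec_def lookup_one)
qed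

text \<open>Multiplication by an element of \<open>I\<close> is null-homotopic; \<open>\<tau>\<close> is one component of the
  homotopy. The identity involving two consecutive components is only recorded on the image of
  \<open>dd k\<close>, where the preceding component drops out, so that \<open>\<tau>\<close> can be treated on its own.\<close>

definition homotopy_component :: "'k mpoly \<Rightarrow> int \<Rightarrow> nat \<Rightarrow> ((nat \<Rightarrow> 'k mpoly) \<Rightarrow> nat \<Rightarrow> 'k mpoly) \<Rightarrow> bool"
  where "homotopy_component f t k \<tau> \<longleftrightarrow>
    \<tau> \<in> gr_hom d (sh k) (sh (Suc k)) \<and>
    (\<forall>e. \<tau> ` gr_component d (sh k) e \<subseteq> gr_component d (sh (Suc k)) (e + t)) \<and>
    (\<forall>y\<in>F (Suc k). dd k (\<tau> (dd k y)) = (\<lambda>i. f * dd k y i))"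

text \<open>The map \<open>h\<close> is what the next homotopy component has to lift through
  \<open>dd (Suc k)\<close>. Its values are cycles by the identity recorded for \<tau>, hence
  boundaries by exactness.\<close>

lemma homotopy_defect:
  fixes \<tau> f k
  defines "h \<equiv> \<lambda>v i. f * v i - \<tau> (dd k v) i"
  assumes \<tau>: "homotopy_component f t k \<tau>" and f: "f \<in> carrier (poly_ring d)" "homogeneous t f"
  shows "h \<in> gr_hom d (sh (Suc k)) (sh (Suc k))"
    and "h ` gr_component d (sh (Suc k)) e \<subseteq> gr_component d (sh (Suc k)) (e + t)"
    and "h ` F (Suc k) \<subseteq> dd (Suc k) ` F (Suc (Suc k))"
proof -
  have \<tau>': "\<tau> \<in> gr_hom d (sh k) (sh (Suc k))" "\<And>y. y \<in> F (Suc k) \<Longrightarrow> dd k (\<tau> (dd k y)) = (\<lambda>i. f * dd k y i)"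
    using \<tau> by (auto simp: homotopy_component_def)
  show h: "h \<in> gr_hom d (sh (Suc k)) (sh (Suc k))"
    unfolding h_def by (intro gr_hom_diff gr_hom_scale f gr_hom_comp[OF dd_hom \<tau>'(1)])
  show "h ` gr_component d (sh (Suc k)) e \<subseteq> gr_component d (sh (Suc k)) (e + t)"
  proof (rule image_subsetI)
    fix x :: "nat \<Rightarrow> 'k mpoly" assume x: "x \<in> gr_component d (sh (Suc k)) e"
    then have "\<tau> (dd k x) \<in> gr_component d (sh (Suc k)) (e + t)"
      using \<tau> dd_graded[of k e] unfolding homotopy_component_def by blast
    with gr_component_scale[OF f x] show "h x \<in> gr_component d (sh (Suc k)) (e + t)"
      unfolding h_def by (rule gr_component_diff)
  qed
  show "h ` F (Suc k) \<subseteq> dd (Suc k) ` F (Suc (Suc k))"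
  proof (rule image_subsetI)
    fix x assume x: "x \<in> F (Suc k)"
    have d: "dd k x \<in> F k" "h x \<in> F (Suc k)"
      using gr_homD(1)[OF dd_hom x] gr_homD(1)[OF h x] .
    then have "\<tau> (dd k x) \<in> F (Suc k)"
      using gr_homD(1)[OF \<tau>'(1)] by blast
    \<comment> \<open>Apply \<open>dd k\<close> to \<open>f x = h x + \<tau> (dd k x)\<close>: the
      second summand already yields all of \<open>f (dd k x)\<close>, leaving zero for
      \<open>dd k (h x)\<close>.\<close>
    with d have "(\<lambda>i. dd k (h x) i + dd k (\<tau> (dd k x)) i) = dd k (\<lambda>i. h x i + \<tau> (dd k x) i)"
      by (simp add: gr_homD(2)[OF dd_hom])
    also have "(\<lambda>i. h x i + \<tau> (dd k x) i) = (\<lambda>i. f * x i)"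
      by (simp add: h_def)
    also have "dd k \<dots> = (\<lambda>i. f * dd k x i)"
      by (rule gr_homD(3)[OF dd_hom f(1) x])
    finally have "dd k (h x) = (\<lambda>i. 0)"
      using \<tau>'(2)[OF x] by (simp add: fun_eq_iff)
    with d(2) show "h x \<in> dd (Suc k) ` F (Suc (Suc k))"
      by (simp add: exact)
  qed
qed

text \<open>Induction by graded lifting. At the start, multiplication by \<open>f\<close> sends
  \<open>F_0\<close> into \<open>I\<close>, the image of \<open>dd 0\<close>; afterwards the defect
  of the previous component is lifted.\<close>

lemma homotopy_component_exists:
  assumes "f \<in> I" and f: "homogeneous t f"
  shows "\<exists>\<tau>. homotopy_component f t k \<tau>"
proof (induction k)
  interpret I: ideal I "poly_ring d" by (rule I)
  have fS: "f \<in> carrier (poly_ring d)"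
    using assms(1) by (rule I.a_Hcarr)
  {
    case 0
    have img: "(\<lambda>v i. f * v i) ` F 0 \<subseteq> dd 0 ` F (Suc 0)"
    proof (rule image_subsetI)
      fix x assume x: "x \<in> F 0"
      then have "x 0 \<in> carrier (poly_ring d)"
        by (simp add: gr_free_carrier)
      then have "f * x 0 \<in> I"
        using I.I_r_closed[OF assms(1)] by simp
      with gr_homD(1)[OF gr_hom_scale[OF fS] x]
      show "(\<lambda>i. f * x i) \<in> dd 0 ` F (Suc 0)"
        using exact_0 by simp
    qed
    have graded: "(\<lambda>v i. f * v i) ` gr_component d (sh 0) e \<subseteq> gr_component d (sh 0) (e + t)" for e
      by (intro image_subsetI gr_component_scale fS f)
    obtain \<tau> where "\<tau> \<in> gr_hom d (sh 0) (sh (Suc 0))"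
      "\<And>e. \<tau> ` gr_component d (sh 0) e \<subseteq> gr_component d (sh (Suc 0)) (e + t)"
      "\<And>x. x \<in> F 0 \<Longrightarrow> dd 0 (\<tau> x) = (\<lambda>i. f * x i)"
      using gr_hom_lift[OF dd_hom dd_graded gr_hom_scale[OF fS] graded img] by blast
    then show ?case
      using gr_homD(1)[OF dd_hom] unfolding homotopy_component_def by blast
  next
    case (Suc k)
    then obtain \<tau> where \<tau>: "homotopy_component f t k \<tau>" ..
    obtain \<sigma> where \<sigma>: "\<sigma> \<in> gr_hom d (sh (Suc k)) (sh (Suc (Suc k)))"
      "\<And>e. \<sigma> ` gr_component d (sh (Suc k)) e \<subseteq> gr_component d (sh (Suc (Suc k))) (e + t)"
      "\<And>x. x \<in> F (Suc k) \<Longrightarrow> dd (Suc k) (\<sigma> x) = (\<lambda>i. f * x i - \<tau> (dd k x) i)"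
      using gr_hom_lift[OF dd_hom dd_graded homotopy_defect[OF \<tau> fS f]] by blast
    \<comment> \<open>On boundaries the term with \<tau> disappears, since two consecutive
      differentials compose to zero.\<close>
    have "dd (Suc k) (\<sigma> (dd (Suc k) y)) = (\<lambda>i. f * dd (Suc k) y i)" if "y \<in> F (Suc (Suc k))" for y
    proof -
      have "dd (Suc k) y \<in> F (Suc k)" "dd k (dd (Suc k) y) = (\<lambda>i. 0)"
        using exact that by blast+
      moreover have "\<tau> (\<lambda>i. 0) = (\<lambda>i. 0)"
        using \<tau> gr_hom_zero unfolding homotopy_component_def by blast
      ultimately show ?thesis
        by (simp add: \<sigma>(3))
    qed
    with \<sigma>(1,2) show ?case
      unfolding homotopy_component_def by blast
  }
qed

text \<open>Here \<open>n = m + 2\<close>. Component \<open>m + 1\<close> of the homotopy is not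
  constructed; instead the defect \<open>h\<close> of component \<open>m\<close>, which it would
  lift, is shown to vanish.\<close>

lemma min_shift_le_if_proj_dim:
  assumes pd: "\<not> proj_dim (poly_ring d) (quotient_module (poly_ring d) I) \<le> enat (Suc m)"
  shows "min_shift sh (Suc (Suc m)) \<le> min_shift sh 1 + max_shift sh (Suc m)"
proof (rule ccontr)
  assume less: "\<not> ?thesis"
  \<comment> \<open>A vanishing \<open>dd k\<close> would allow truncation at \<open>k\<close>. The
    case \<open>k = 0\<close> shows that \<open>F_1\<close> is nonzero, so that its minimal shift is
    attained; the case \<open>k = Suc m\<close> gives the final contradiction.\<close>
  have nonzero: "dd k ` F (Suc k) \<noteq> {\<lambda>i. 0}" if "k \<le> Suc m" for k
    using proj_dim_le_truncation[OF resolution, of k] pd that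
    by (meson enat_ord_simps(1) order_trans)
  have "sh (Suc 0) \<noteq> []"
    using nonzero[of 0] gr_hom_zero[OF dd_hom, of 0] gr_free_Nil by (metis image_insert image_empty le0)
  then obtain j0 where j0: "j0 < length (sh (Suc 0))" "sh (Suc 0) ! j0 = min_shift sh (Suc 0)"
    by (rule min_shift_attained)
  define t where "t = min_shift sh (Suc 0)"
  \<comment> \<open>As \<open>F_0\<close> has rank one, the image of a generator of least degree in
    \<open>F_1\<close> is a single polynomial, of degree \<open>t\<close>.\<close>
  define f where "f = dd 0 (unit_vec j0) 0"
  have "dd 0 (unit_vec j0) \<in> gr_component d (sh 0) t"
    using dd_graded unit_vec_component[OF j0(1)] j0(2) unfolding t_def by fastforce
  then have f: "homogeneous t f" and ddF: "dd 0 (unit_vec j0) \<in> F 0"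
    by (auto simp: gr_component_def sh_0 f_def)
  have "f \<in> I"
    using exact_0 unit_vec_carrier[OF j0(1)] unfolding f_def by fastforce
  then have fS: "f \<in> carrier (poly_ring d)"
    using ddF by (simp add: gr_free_carrier f_def)
  have "f \<noteq> 0"
  proof
    assume "f = 0"
    then have "dd 0 (unit_vec j0) i = 0" for i
      using ddF by (cases i) (auto simp: gr_free_carrier sh_0 f_def)
    with dd_unit_vec_nonzero[OF j0(1)] show False
      by auto
  qed
  obtain \<tau> where \<tau>: "homotopy_component f t m \<tau>"
    using homotopy_component_exists[OF \<open>f \<in> I\<close> f] ..
  define h where "h = (\<lambda>v i. f * v i - \<tau> (dd m v) i)"
  note h = homotopy_defect[OF \<tau> fS f, folded h_def]
  have h_basis: "h (unit_vec j) = (\<lambda>i. 0)" if j: "j < length (sh (Suc m))" for j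
  proof -
    have "h (unit_vec j) \<in> gr_component d (sh (Suc m)) (sh (Suc m) ! j + t)"
      "h (unit_vec j) \<in> dd (Suc m) ` F (Suc (Suc m))"
      using h(2,3) unit_vec_component[OF j, of d] unit_vec_carrier[OF j, of d] by blast+
    then obtain x where x: "x \<in> gr_component d (sh (Suc (Suc m))) (sh (Suc m) ! j + t)"
      "dd (Suc m) x = h (unit_vec j)"
      using gr_hom_homogeneous_preimage[OF dd_hom dd_graded] by blast
    \<comment> \<open>The degree of \<open>x\<close> is at most \<open>t\<close> plus the maximal
      shift of \<open>F_(m+1)\<close>, which by the contrary assumption lies below all shifts of
      \<open>F_(m+2)\<close>.\<close>
    have "x = (\<lambda>i. 0)"
    proof (rule gr_component_eq_zero[OF x(1)])
      fix i assume "i < length (sh (Suc (Suc m)))"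
      with less min_shift_le[of i sh "Suc (Suc m)"] max_shift_ge[of j sh "Suc m"] j
      show "sh (Suc m) ! j + t < sh (Suc (Suc m)) ! i"
        by (simp add: t_def)
    qed
    with x(2) show ?thesis
      using gr_hom_zero[OF dd_hom] by metis
  qed
  \<comment> \<open>Since \<open>h\<close> is zero, \<open>f x = \<tau> (dd m x)\<close>; on the
    kernel of \<open>dd m\<close> this gives \<open>f x = 0\<close>, and polynomials over a field
    have no zero divisors.\<close>
  have "x = (\<lambda>i. 0)" if x: "x \<in> F (Suc m)" "dd m x = (\<lambda>i. 0)" for x
  proof -
    have "h x = (\<lambda>i. 0)"
      using gr_hom_lincomb[OF h(1) x(1)] h_basis by (simp add: lincomb_def)
    moreover have "\<tau> (\<lambda>i. 0) = (\<lambda>i. 0)"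
      using \<tau> gr_hom_zero unfolding homotopy_component_def by blast
    ultimately have "(\<lambda>i. f * x i) = (\<lambda>i. 0)"
      using x(2) by (simp add: h_def)
    then have "f * x i = 0" for i
      by (rule fun_cong)
    with \<open>f \<noteq> 0\<close> show ?thesis
      by auto
  qed
  moreover have "(\<lambda>i. 0) \<in> dd (Suc m) ` F (Suc (Suc m))"
    using exact gr_hom_zero[OF dd_hom] by (auto simp: gr_free_carrier zero_in_poly_ring)
  ultimately have "dd (Suc m) ` F (Suc (Suc m)) = {\<lambda>i. 0}"
    using exact by blast
  with nonzero[of "Suc m"] show False
    by simp
qed

end

theorem theorem2p1:
  fixes d s :: nat
    and I :: "'k::field mpoly set"
    and sh :: "nat \<Rightarrow> int list"
    and dd :: "nat \<Rightarrow> (nat \<Rightarrow> 'k mpoly) \<Rightarrow> (nat \<Rightarrow> 'k mpoly)"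
  assumes "homogeneous_ideal d I"
    and "I \<subset> carrier (poly_ring d)"
    and "proj_dim (poly_ring d) (quotient_module (poly_ring d) I) = enat s"
    and "minimal_graded_free_resolution d I sh dd"
  shows "\<forall>n. 1 \<le> n \<and> n \<le> s \<longrightarrow> min_shift sh n \<le> min_shift sh 1 + max_shift sh (n - 1)"
proof (intro allI impI)
  fix n assume n: "1 \<le> n \<and> n \<le> s"
  interpret S: cring "poly_ring d" by (rule poly_ring_cring)
  have "ideal I (poly_ring d)"
    using assms(1) by (auto simp: homogeneous_ideal_def intro!: S.genideal_ideal)
  then interpret quotient_resolution d I sh dd
    using assms(4) by (rule quotient_resolution.intro)
  \<comment> \<open>For \<open>n = 1\<close> the bound is immediate because
    \<open>sh 0 = [0]\<close> makes the maximal shift of \<open>F_0\<close> zero.\<close>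
  consider "n = 1" | m where "n = Suc (Suc m)"
    using n by (metis One_nat_def not0_implies_Suc not_one_le_zero)
  then show "min_shift sh n \<le> min_shift sh 1 + max_shift sh (n - 1)"
  proof cases
    case 1
    then show ?thesis
      unfolding max_shift_def shift_set by (simp add: sh_0)
  next
    \<comment> \<open>\<open>m + 2 \<le> s\<close> says exactly that the projective dimension is not
      at most \<open>m + 1\<close>.\<close>
    case 2
    then show ?thesis
      using min_shift_le_if_proj_dim[of m] assms(3) n by simp
  qed
qed

end
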